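(* Let $K>1$ and let $\theta\in[0,1]^N$, not all entries zero, be unknown to the users. Suppose all $K$ users follow the two-phase adaptive rule described in the context. Then the scheme converges in probability, as $T$ increases, to the optimal symmetric operating point $\mathbf p^*$ of the known-$\theta$ problem: for every user $k$, channel $i$, $\varepsilon>0$, and every choice of slots $j_T$ with $\ln T\le j_T\le T$ (lying in the second phase of the rule), $$\lim_{T\to\infty}\Pr\{|\hat p^*_{k,i}(j_T)-p_i^*|>\varepsilon\}=0 ,$$ where $\hat p^*_{k,i}(j)$ is the probability with which user $k$ senses channel $i$ in slot $j$.
   Context: There are $N$ channels, $K$ users and time slots $j=1,\dots,T$. $Z_i(j)$ are independent Bernoulli($\theta_i$) variables ($Z_i(j)=1$ means channel $i$ is free in slot $j$). In slot $j$ user $k$ senses one channel and observes whether it is free. If channel $i$ is free, one user chosen uniformly at random among those sensing it transmits. Optimal operating point for known $\theta$ (the symmetric sensing distribution maximizing the common expected per-user throughput): $p_i^*=\{1-(\lambda^*/(K\theta_i))^{1/(K-1)}\}^+$ if $\theta_i>0$ and $p_i^*=0$ if $\theta_i=0$, where $\{x\}^+=\max\{0,x\}$ and $\lambda^*\ge0$ is a constant such that $\sum_ip_i^*=1$. Two-phase adaptive rule (followed by each user $k$). User $k$ keeps $Y_{k,i}$, the number of slots in which it has sensed channel $i$, and $X_{k,i}$, the number of slots in which it has sensed channel $i$ to be free. Initialization: in the first $N$ slots it senses each channel once, then sets $X_{k,i}=1$ for all $i$ regardless of the sensing results (so $X_{k,i}=Y_{k,i}=1$). At the beginning of each later slot $j$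 it computes $\hat\theta_{k,i}(j)=X_{k,i}(j)/Y_{k,i}(j)>0$. First phase, slots $j<\ln T$: it senses channel $i$ with probability $\hat\theta_{k,i}(j)/\sum_{l=1}^N\hat\theta_{k,l}(j)$. Second phase, slots $j\ge\ln T$: it senses channel $i$ with probability $$\hat p^*_{k,i}(j)=\left\{1-\left(\frac{\hat\lambda}{\hat\theta_{k,i}(j)}\right)^{1/(K-1)}\right\}^{+},$$ where $\hat\lambda\ge0$ is the normalizing constant making $\sum_{i=1}^N\hat p^*_{k,i}(j)=1$. The users' randomizations are independent given the past. After each sensing, $X_{k,i}$ and $Y_{k,i}$ are updated. *)

theory Defs
  imports "HOL-Probability.Probability"
begin

text \<open>
  Channels are numbered \<open>1..N\<close>, users \<open>1..K\<close>, slots \<open>1, 2, \<dots>\<close>.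
  A path assigns to each slot \<open>t\<close> a pair: the channel sensed by each user, and whether each
  channel is free.  Which of the users sensing a free channel gets to transmit does not influence
  any sensing decision and is therefore not recorded.
\<close>

type_synonym path = "nat \<Rightarrow> (nat \<Rightarrow> nat) \<times> (nat \<Rightarrow> bool)"

definition sensed :: "path \<Rightarrow> nat \<Rightarrow> nat \<Rightarrow> nat" where
  "sensed h k t = fst (h t) k"

definition free :: "path \<Rightarrow> nat \<Rightarrow> nat \<Rightarrow> bool" where
  "free h i t = snd (h t) i"


text \<open>
  With \<open>w i = K * \<theta> i\<close> the following is the optimal operating point for known \<open>\<theta>\<close>; with
  \<open>w\<close> the estimates of \<open>\<theta>\<close> it is the sensing distribution of the second phase.
  Note that \<open>0 powr a = 0\<close>, so \<open>lam = 0\<close> yields the value 1 on every channel of positive weight.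
\<close>

definition channel_prob :: "nat \<Rightarrow> real \<Rightarrow> (nat \<Rightarrow> real) \<Rightarrow> nat \<Rightarrow> real" where
  "channel_prob K lam w i =
     (if w i > 0 then max 0 (1 - (lam / w i) powr (1 / (real K - 1))) else 0)"

definition normalizing :: "nat \<Rightarrow> nat \<Rightarrow> (nat \<Rightarrow> real) \<Rightarrow> real \<Rightarrow> bool" where
  "normalizing K N w lam \<longleftrightarrow> 0 \<le> lam \<and> (\<Sum>i=1..N. channel_prob K lam w i) = 1"

definition normalized_prob :: "nat \<Rightarrow> nat \<Rightarrow> (nat \<Rightarrow> real) \<Rightarrow> nat \<Rightarrow> real" where
  "normalized_prob K N w = channel_prob K (SOME lam. normalizing K N w lam) w"

lemma normalizing_exists:
  assumes "K > 1" and pos: "\<exists>i\<in>{1..N}. w i > 0"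
  shows "\<exists>lam. normalizing K N w lam"
proof -
  define g where "g = (\<lambda>lam. \<Sum>i=1..N. channel_prob K lam w i)"
  define M where "M = (\<Sum>i=1..N. max 0 (w i))"
  have M0: "M \<ge> 0" unfolding M_def by (intro sum_nonneg) auto
  have e: "1 / (real K - 1) > 0" using assms(1) by simp
  have "channel_prob K M w i = 0" if "i \<in> {1..N}" for i
  proof (cases "w i > 0")
    case True
    have "max 0 (w i) \<le> M" unfolding M_def using that by (intro member_le_sum) auto
    then have "1 \<le> M / w i" using True by simp
    then have "1 \<le> (M / w i) powr (1 / (real K - 1))" using e by (intro ge_one_powr_ge_zero) auto
    then show ?thesis by (simp add: channel_prob_def)
  qed (simp add: channel_prob_def)
  then have gM: "g M = 0" by (simp add: g_def)
  obtain i0 where i0: "i0 \<in> {1..N}" "w i0 > 0" using pos by blast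
  have "channel_prob K 0 w i0 \<le> g 0" unfolding g_def
    using i0 by (intro member_le_sum) (auto simp: channel_prob_def)
  then have g0: "1 \<le> g 0" using i0 by (simp add: channel_prob_def)
  have cont: "continuous_on {0..M} (\<lambda>lam. channel_prob K lam w i)" for i
  proof (cases "w i > 0")
    case True
    then show ?thesis unfolding channel_prob_def using e
      by (auto intro!: continuous_intros continuous_on_powr')
  qed (simp add: channel_prob_def)
  have "continuous_on {0..M} g" unfolding g_def by (intro continuous_on_sum cont)
  then obtain lam where "0 \<le> lam" "g lam = 1"
    using IVT2'[of g M 1 0] gM g0 M0 by auto
  then show ?thesis by (auto simp: normalizing_def g_def)
qed

definition p_star :: "nat \<Rightarrow> nat \<Rightarrow> (nat \<Rightarrow> real) \<Rightarrow> nat \<Rightarrow> real" where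
  "p_star K N \<theta> = normalized_prob K N (\<lambda>i. real K * \<theta> i)"

text \<open>
  Sensing channel \<open>i\<close> with probability \<open>p i\<close> independently, the \<open>K\<close> users leave a free channel
  \<open>i\<close> unused with probability \<open>(1 - p i) ^ K\<close>; by symmetry each user gets an equal share.
\<close>

definition throughput :: "nat \<Rightarrow> nat \<Rightarrow> (nat \<Rightarrow> real) \<Rightarrow> (nat \<Rightarrow> real) \<Rightarrow> real" where
  "throughput K N \<theta> p = (\<Sum>i=1..N. \<theta> i * (1 - (1 - p i) ^ K)) / real K"

lemma power_tangent:
  fixes a b :: real
  assumes "a \<ge> 0" "b \<ge> 0"
  shows "a ^ K + real K * a ^ (K - 1) * (b - a) \<le> b ^ K"
proof (induction K)
  case (Suc K)
  show ?case
  proof (cases K)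
    case [simp]: (Suc K')
    have "a ^ K + real K * a ^ (K - 1) * (b - a) \<le> b ^ K" by (rule Suc.IH)
    then have "b * (a ^ K + real K * a ^ (K - 1) * (b - a)) \<le> b * b ^ K"
      using assms(2) by (rule mult_left_mono)
    moreover have "b * (a ^ K + real K * a ^ (K - 1) * (b - a)) -
        (a ^ Suc K + real (Suc K) * a ^ K * (b - a)) = real K * a ^ (K - 1) * (b - a)\<^sup>2"
      by (simp add: algebra_simps power2_eq_square)
    moreover have "real K * a ^ (K - 1) * (b - a)\<^sup>2 \<ge> 0" using assms by simp
    ultimately show ?thesis by simp
  qed simp
qed simp

lemma p_star_optimal:
  assumes "K > 1" and th: "\<forall>l\<in>{1..N}. 0 \<le> \<theta> l" and nz: "\<exists>l\<in>{1..N}. \<theta> l \<noteq> 0"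
    and q: "\<forall>l\<in>{1..N}. 0 \<le> q l" "(\<Sum>l=1..N. q l) = 1"
  shows "throughput K N \<theta> q \<le> throughput K N \<theta> (p_star K N \<theta>)"
proof -
  let ?w = "\<lambda>i. real K * \<theta> i"
  define lam where "lam = (SOME lam. normalizing K N ?w lam)"
  let ?p = "channel_prob K lam ?w"
  have "\<exists>lam. normalizing K N ?w lam"
    using assms by (intro normalizing_exists) (auto simp: less_le)
  then have "normalizing K N ?w lam" unfolding lam_def by (rule someI_ex)
  then have lam0: "0 \<le> lam" and p1: "(\<Sum>i=1..N. ?p i) = 1" by (auto simp: normalizing_def)
  have q1: "q l \<le> 1" if "l \<in> {1..N}" for l
    using member_le_sum[of l "{1..N}" q] q that by auto
  have step: "\<theta> i * (1 - (1 - q i) ^ K) - \<theta> i * (1 - (1 - ?p i) ^ K) \<le> lam * (q i - ?p i)"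
    if i: "i \<in> {1..N}" for i
  proof (cases "\<theta> i > 0")
    case True
    define r where "r = (lam / ?w i) powr (1 / (real K - 1))"
    have w: "?w i > 0" using True assms(1) by simp
    have r0: "r \<ge> 0" by (simp add: r_def)
    have "r ^ (K - 1) = r powr (real K - 1)"
      using assms(1) r0 by (cases "r = 0") (auto simp: powr_realpow[symmetric] of_nat_diff)
    then have rK: "?w i * r ^ (K - 1) = lam"
      using assms(1) lam0 w by (auto simp: r_def powr_powr)
    have p: "?p i = max 0 (1 - r)" using w by (simp add: channel_prob_def r_def)
    have "(1 - ?p i) ^ K + real K * (1 - ?p i) ^ (K - 1) * ((1 - q i) - (1 - ?p i)) \<le> (1 - q i) ^ K"
      using q1[OF i] r0 p by (intro power_tangent) auto
    then have "\<theta> i * (((1 - ?p i) ^ K - (1 - q i) ^ K)) \<le>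
        \<theta> i * (real K * (1 - ?p i) ^ (K - 1) * (q i - ?p i))"
      using True by (intro mult_left_mono) (auto simp: algebra_simps)
    also have "\<dots> = (?w i * (1 - ?p i) ^ (K - 1)) * (q i - ?p i)" by (simp add: algebra_simps)
    also have "\<dots> \<le> lam * (q i - ?p i)"
    proof (cases "r \<le> 1")
      case True
      then show ?thesis using p rK by simp
    next
      case False
      then have "1 \<le> r ^ (K - 1)" by (intro one_le_power) simp
      then have "?w i * 1 \<le> ?w i * r ^ (K - 1)" using w by (intro mult_left_mono) auto
      then have "?w i \<le> lam" using rK by simp
      then show ?thesis using False p q(1) i by (auto intro: mult_right_mono)
    qed
    finally show ?thesis by (simp add: algebra_simps)
  next
    case False
    then have "\<theta> i = 0" using th i by force
    then show ?thesis using lam0 q(1) i by (simp add: channel_prob_def)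
  qed
  have "(\<Sum>i=1..N. \<theta> i * (1 - (1 - q i) ^ K) - \<theta> i * (1 - (1 - ?p i) ^ K))
      \<le> (\<Sum>i=1..N. lam * (q i - ?p i))"
    by (intro sum_mono step)
  also have "\<dots> = 0" using q(2) p1 by (simp add: sum_distrib_left[symmetric] sum_subtractf)
  finally show ?thesis
    by (simp add: throughput_def p_star_def normalized_prob_def lam_def sum_subtractf divide_right_mono)
qed


text \<open>
  \<open>Y\<close>, \<open>X\<close>, the estimate and the probabilities below refer to the beginning of slot \<open>j\<close>, that is,
  they depend on the slots before \<open>j\<close> only.  \<open>X\<close> is meaningful for \<open>j > N\<close>: the summand 1 is the
  value to which it is set after the \<open>N\<close> slots of the initialization.
\<close>

definition Y :: "path \<Rightarrow> nat \<Rightarrow> nat \<Rightarrow> nat \<Rightarrow> nat" where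
  "Y h k i j = card {t \<in> {1..<j}. sensed h k t = i}"

definition X :: "nat \<Rightarrow> path \<Rightarrow> nat \<Rightarrow> nat \<Rightarrow> nat \<Rightarrow> nat" where
  "X N h k i j = 1 + card {t \<in> {N<..<j}. sensed h k t = i \<and> free h i t}"

definition theta_hat :: "nat \<Rightarrow> path \<Rightarrow> nat \<Rightarrow> nat \<Rightarrow> nat \<Rightarrow> real" where
  "theta_hat N h k i j = real (X N h k i j) / real (Y h k i j)"

definition p_hat :: "nat \<Rightarrow> nat \<Rightarrow> path \<Rightarrow> nat \<Rightarrow> nat \<Rightarrow> nat \<Rightarrow> real" where
  "p_hat K N h k i j = normalized_prob K N (\<lambda>l. theta_hat N h k l j) i"

text \<open>
  \<open>\<sigma> k t\<close> is the channel sensed by user \<open>k\<close> in slot \<open>t \<le> N\<close>.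
\<close>

definition sense_prob ::
  "nat \<Rightarrow> nat \<Rightarrow> (nat \<Rightarrow> nat \<Rightarrow> nat) \<Rightarrow> nat \<Rightarrow> path \<Rightarrow> nat \<Rightarrow> nat \<Rightarrow> nat \<Rightarrow> real" where
  "sense_prob K N \<sigma> T h k j i =
     (if i \<notin> {1..N} then 0
      else if j \<le> N then (if i = \<sigma> k j then 1 else 0)
      else if real j < ln (real T)
        then theta_hat N h k i j / (\<Sum>l=1..N. theta_hat N h k l j)
      else p_hat K N h k i j)"

text \<open>
  The premises hold on every path of positive probability: the initialization senses each channel.
\<close>

lemma pmf_sense_prob:
  assumes "K > 1" and sig: "j \<in> {1..N} \<Longrightarrow> \<sigma> k j \<in> {1..N}"
    and Y: "j > N \<Longrightarrow> \<forall>l\<in>{1..N}. Y h k l j > 0" and "N > 0" and "j > 0"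
  shows "pmf (embed_pmf (sense_prob K N \<sigma> T h k j)) i = sense_prob K N \<sigma> T h k j i"
proof (rule pmf_embed_pmf)
  let ?f = "sense_prob K N \<sigma> T h k j"
  have th: "theta_hat N h k l j > 0" if "j > N" "l \<in> {1..N}" for l
    using Y that by (simp add: theta_hat_def X_def)
  have th0: "theta_hat N h k l j \<ge> 0" for l
    by (simp add: theta_hat_def)
  have "(\<Sum>l=1..N. theta_hat N h k l j) \<ge> 0"
    using th0 by (intro sum_nonneg)
  then show nn: "?f i \<ge> 0" for i
    using th0 unfolding sense_prob_def p_hat_def normalized_prob_def channel_prob_def
    by (auto intro: divide_nonneg_nonneg)
  have "(\<Sum>i=1..N. ?f i) = 1"
  proof -
    consider "j \<le> N" | "j > N" "real j < ln (real T)" | "j > N" "\<not> real j < ln (real T)" by linarith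
    then show ?thesis
    proof cases
      case 1
      then have "\<sigma> k j \<in> {1..N}" using sig assms(5) by simp
      then show ?thesis using 1 by (simp add: sense_prob_def)
    next
      case 2
      have "(\<Sum>l=1..N. theta_hat N h k l j) > 0" using th 2 assms(4) by (intro sum_pos) auto
      then show ?thesis using 2 by (simp add: sense_prob_def sum_divide_distrib[symmetric])
    next
      case 3
      have "\<exists>lam. normalizing K N (\<lambda>l. theta_hat N h k l j) lam"
        using th[OF 3(1)] assms by (intro normalizing_exists bexI[of _ 1]) auto
      from someI_ex[OF this] show ?thesis
        using 3 by (simp add: sense_prob_def p_hat_def normalized_prob_def normalizing_def)
    qed
  qed
  moreover have "(\<integral>\<^sup>+ i. ennreal (?f i) \<partial>count_space UNIV) = (\<Sum>i=1..N. ennreal (?f i))"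
    by (rule nn_integral_count_space') (auto simp: sense_prob_def split: if_splits)
  ultimately show "(\<integral>\<^sup>+ i. ennreal (?f i) \<partial>count_space UNIV) = 1"
    using nn by (metis ennreal_1 sum_ennreal)
qed

definition slot_pmf ::
  "nat \<Rightarrow> nat \<Rightarrow> (nat \<Rightarrow> real) \<Rightarrow> (nat \<Rightarrow> nat \<Rightarrow> nat) \<Rightarrow> nat \<Rightarrow> path \<Rightarrow> nat \<Rightarrow>
     ((nat \<Rightarrow> nat) \<times> (nat \<Rightarrow> bool)) pmf" where
  "slot_pmf K N \<theta> \<sigma> T h j =
     pair_pmf
       (Pi_pmf {1..K} 0 (\<lambda>k. embed_pmf (sense_prob K N \<sigma> T h k j)))
       (Pi_pmf {1..N} False (\<lambda>i. bernoulli_pmf (\<theta> i)))"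

text \<open>
  The law of the first \<open>m\<close> slots when the horizon is \<open>T\<close>; later slots carry a dummy value.
\<close>

primrec path_pmf ::
  "nat \<Rightarrow> nat \<Rightarrow> (nat \<Rightarrow> real) \<Rightarrow> (nat \<Rightarrow> nat \<Rightarrow> nat) \<Rightarrow> nat \<Rightarrow> nat \<Rightarrow> path pmf" where
  "path_pmf K N \<theta> \<sigma> T 0 = return_pmf (\<lambda>_. (\<lambda>_. 0, \<lambda>_. False))"
| "path_pmf K N \<theta> \<sigma> T (Suc m) =
     bind_pmf (path_pmf K N \<theta> \<sigma> T m)
       (\<lambda>h. map_pmf (\<lambda>s. h(Suc m := s)) (slot_pmf K N \<theta> \<sigma> T h (Suc m)))"

end

theory Submission
  imports Defs
begin

text \<open>
  For a user \<open>u\<close> and a channel \<open>l\<close> with counts \<open>X\<close>, \<open>Y\<close>, put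
  \<open>W = exp (s (X - \<theta> Y) - s\<^sup>2 / 4 Y)\<close>.  A slot in which the channel is sensed multiplies \<open>W\<close>, in
  conditional mean, by at most \<open>exp (- s\<^sup>2 / 8)\<close> (Hoeffding's lemma), any other slot leaves it alone.
  In slot \<open>t\<close> of the first phase the channel is sensed with probability at least \<open>1 / (N t)\<close>, because
  an estimate is at least \<open>1 / Y \<ge> 1 / t\<close> and at most 1; the second phase never increases the mean.
  Hence \<open>E W\<close> decays like \<open>exp (- c \<Sum>\<^bsub>N < t < ln T\<^esub> 1 / t)\<close>, which tends to 0 as the harmonic
  series diverges.  With \<open>s = 4 \<delta>\<close> or \<open>s = - 4 \<delta>\<close> a deviation of the estimate by \<open>\<delta>\<close>
  forces \<open>W \<ge> 1\<close>, so Markov's inequality gives convergence of the estimates in probability.  The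
  operating point depends continuously on the estimates, even where \<open>\<theta>\<close> has zero entries.
\<close>

section \<open>Dependence of the operating point on the weights\<close>

text \<open>Every \<open>channel_prob\<close> is antitone in the constant. Two normalizing constants
  therefore give families that are ordered termwise and have equal sums, so the terms agree. Thus
  any normalizing constant may stand for the one picked by \<open>SOME\<close>.\<close>

lemma normalizing_channel_prob_unique:
  assumes K: "K > 1" and i: "i \<in> {1..N}"
    and "normalizing K N w a" "normalizing K N w b"
  shows "channel_prob K a w i = channel_prob K b w i"
proof -
  have main: "channel_prob K a w i = channel_prob K b w i"
    if ab: "a \<le> b" and na: "normalizing K N w a" and nb: "normalizing K N w b" for a b
  proof -
    have le: "channel_prob K b w l \<le> channel_prob K a w l" for l
    proof (cases "w l > 0")
      case True
      have "(a / w l) powr (1 / (real K - 1)) \<le> (b / w l) powr (1 / (real K - 1))"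
        using True ab na K by (intro powr_mono2) (auto simp: normalizing_def divide_right_mono)
      then show ?thesis by (auto simp: channel_prob_def max_def)
    qed (simp add: channel_prob_def)
    have "(\<Sum>l=1..N. channel_prob K a w l - channel_prob K b w l) = 0"
      using na nb by (simp add: normalizing_def sum_subtractf)
    then show ?thesis
      using le i by (subst (asm) sum_nonneg_eq_0_iff) auto
  qed
  show ?thesis using main[of a b] main[of b a] assms(3,4) by linarith
qed

lemma normalized_prob_eq:
  assumes "K > 1" "i \<in> {1..N}" "normalizing K N w a"
  shows "normalized_prob K N w i = channel_prob K a w i"
  unfolding normalized_prob_def
  by (rule normalizing_channel_prob_unique[OF assms(1,2) someI[of "normalizing K N w", OF assms(3)] assms(3)])

lemma channel_prob_scale:
  assumes "c > 0"
  shows "channel_prob K a (\<lambda>l. c * w l) = channel_prob K (a / c) w"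
  using assms by (auto simp: channel_prob_def fun_eq_iff zero_less_mult_iff)

text \<open>Multiplying all weights by \<open>K\<close> is compensated by multiplying the constant
  by \<open>K\<close>. Hence target and estimate are values of the same function
  \<open>normalized_prob K N\<close>, at \<theta> and at the estimates.\<close>

lemma p_star_eq_normalized_prob:
  assumes K: "K > 1" and i: "i \<in> {1..N}" and pos: "\<exists>l\<in>{1..N}. \<theta> l > 0"
  shows "p_star K N \<theta> i = normalized_prob K N \<theta> i"
proof -
  have K0: "real K > 0" using K by simp
  obtain a where a: "normalizing K N \<theta> a"
    using normalizing_exists[OF K pos] by blast
  have "channel_prob K (real K * a) (\<lambda>l. real K * \<theta> l) = channel_prob K a \<theta>"
    using channel_prob_scale[OF K0, of K "real K * a" \<theta>] K0 by simp
  then have "normalizing K N (\<lambda>l. real K * \<theta> l) (real K * a)"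
    "channel_prob K (real K * a) (\<lambda>l. real K * \<theta> l) i = channel_prob K a \<theta> i"
    using a by (auto simp: normalizing_def)
  then show ?thesis
    unfolding p_star_def using normalized_prob_eq[OF K i] a by metis
qed

lemma channel_prob_nonneg: "channel_prob K a w l \<ge> 0"
  by (simp add: channel_prob_def)

lemma tendsto_channel_prob:
  assumes K: "K > 1" and "\<theta> l > 0" "a \<longlonglongrightarrow> b" "(\<lambda>n. w n l) \<longlonglongrightarrow> \<theta> l" "\<And>n. w n l > 0" "\<And>n. a n \<ge> 0"
  shows "(\<lambda>n. channel_prob K (a n) (w n) l) \<longlonglongrightarrow> channel_prob K b \<theta> l"
proof -
  have "(\<lambda>n. (a n / w n l) powr (1 / (real K - 1))) \<longlonglongrightarrow> (b / \<theta> l) powr (1 / (real K - 1))"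
    \<comment> \<open>The limit \<open>b\<close> may be 0; there the power still converges because
      its exponent is positive and the bases are nonnegative.\<close>
    using assms by (intro tendsto_powr' tendsto_divide) (auto simp: less_imp_le intro!: always_eventually)
  then show ?thesis
    using assms(2,5) unfolding channel_prob_def by (auto intro!: tendsto_intros)
qed

text \<open>A compactness argument: the normalizing constants are bounded, so a subsequence
  converges to some \<open>b\<close>, and the limit of the normalization identity shows that
  \<open>b\<close> normalizes \<theta>. The delicate channels are those with
  \<open>\<theta> l = 0\<close>, where \<open>lam / w\<close> has no limit in general. A subsequence
  is enough for the proof by contradiction of continuity.\<close>

lemma normalized_prob_tendsto:
  fixes w :: "nat \<Rightarrow> nat \<Rightarrow> real"
  assumes K: "K > 1" and i: "i \<in> {1..N}"
    and th: "\<forall>l\<in>{1..N}. \<theta> l \<ge> 0" "\<exists>l\<in>{1..N}. \<theta> l > 0"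
    and wpos: "\<And>n l. l \<in> {1..N} \<Longrightarrow> w n l > 0"
    and wlim: "\<And>l. l \<in> {1..N} \<Longrightarrow> (\<lambda>n. w n l) \<longlonglongrightarrow> \<theta> l"
  shows "\<exists>r. strict_mono (r::nat\<Rightarrow>nat) \<and> (\<lambda>n. normalized_prob K N (w (r n)) i) \<longlonglongrightarrow> normalized_prob K N \<theta> i"
proof -
  have "\<exists>a. normalizing K N (w n) a" for n
    using wpos th(2) by (intro normalizing_exists[OF K]) blast
  then obtain a where a: "\<And>n. normalizing K N (w n) (a n)" by metis
  have a0: "a n \<ge> 0" and a1: "(\<Sum>l=1..N. channel_prob K (a n) (w n) l) = 1" for n
    using a by (auto simp: normalizing_def)
  \<comment> \<open>Some channel has positive probability, which forces its weight to exceed the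
    constant.\<close>
  have ale: "a n \<le> (\<Sum>l=1..N. w n l)" for n
  proof -
    have "\<not> (\<forall>l\<in>{1..N}. channel_prob K (a n) (w n) l = 0)"
      using a1[of n] sum.neutral[of "{1..N}" "channel_prob K (a n) (w n)"] by linarith
    then obtain l where l: "l \<in> {1..N}" "channel_prob K (a n) (w n) l > 0"
      using channel_prob_nonneg[of K "a n" "w n"] by (auto simp: less_le)
    have "(a n / w n l) powr (1 / (real K - 1)) < 1"
      using l wpos[OF l(1)] by (simp add: channel_prob_def split: if_splits)
    moreover have "1 \<le> (a n / w n l) powr (1 / (real K - 1))" if "1 \<le> a n / w n l"
      using that K by (intro ge_one_powr_ge_zero) auto
    ultimately have "a n / w n l < 1" by linarith
    then have "a n < w n l" using wpos[OF l(1), of n] by simp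
    also have "\<dots> \<le> (\<Sum>l=1..N. w n l)"
      using l wpos by (intro member_le_sum) (auto simp: less_imp_le)
    finally show ?thesis by simp
  qed
  have "convergent (\<lambda>n. \<Sum>l=1..N. w n l)"
    by (intro convergentI[where L = "\<Sum>l=1..N. \<theta> l"] tendsto_sum wlim)
  then have "Bseq (\<lambda>n. \<Sum>l=1..N. w n l)" by (rule convergent_imp_Bseq)
  moreover have "\<forall>\<^sub>F n in sequentially. norm (a n) \<le> norm (\<Sum>l=1..N. w n l)"
    using a0 ale by (intro always_eventually allI) (auto intro: order.trans[OF _ abs_ge_self])
  ultimately have "Bseq a"
    by (rule Bseq_eventually_mono[rotated])
  then have "bounded (range a)" by (simp add: Bseq_eq_bounded)
  then obtain b r where r: "strict_mono r" "(a \<circ> r) \<longlonglongrightarrow> b"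
    using bounded_imp_convergent_subsequence by blast
  have ar: "(\<lambda>n. a (r n)) \<longlonglongrightarrow> b" using r(2) by (simp add: o_def)
  have b0: "b \<ge> 0" using a0 by (intro LIMSEQ_le_const[OF ar]) auto
  have wr: "(\<lambda>n. w (r n) l) \<longlonglongrightarrow> \<theta> l" if "l \<in> {1..N}" for l
    using LIMSEQ_subseq_LIMSEQ[OF wlim[OF that] r(1)] by (simp add: o_def)
  let ?p = "\<lambda>n. channel_prob K (a (r n)) (w (r n))"
  define P where "P = {l \<in> {1..N}. \<theta> l > 0}"
  have limP: "(\<lambda>n. ?p n l) \<longlonglongrightarrow> channel_prob K b \<theta> l" if "l \<in> P" for l
    using that wr ar a0 wpos by (intro tendsto_channel_prob K) (auto simp: P_def)
  have limZ: "(\<lambda>n. ?p n l) \<longlonglongrightarrow> 0" if l: "l \<in> {1..N} - P" for l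
  proof (cases "b = 0")
    case True
    text \<open>Here every channel of positive weight gets the full mass in the limit, so there is
      just one such channel and nothing is left for the others.\<close>
    have cP: "channel_prob K b \<theta> l' = 1" if "l' \<in> P" for l'
      using that True by (simp add: channel_prob_def P_def)
    obtain l0 where l0: "l0 \<in> P" using th(2) by (auto simp: P_def)
    have le: "?p n l \<le> 1 - ?p n l0" for n
    proof -
      have "(\<Sum>l'\<in>{l, l0}. ?p n l') \<le> (\<Sum>l'=1..N. ?p n l')"
        using l l0 by (intro sum_mono2) (auto simp: P_def channel_prob_nonneg)
      moreover have "l \<noteq> l0" using l l0 by blast
      ultimately show ?thesis using a1[of "r n"] by simp
    qed
    have "(\<lambda>n. 1 - ?p n l0) \<longlonglongrightarrow> 1 - 1"
      using limP[OF l0] unfolding cP[OF l0] by (rule tendsto_diff[OF tendsto_const])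
    then have "(\<lambda>n. 1 - ?p n l0) \<longlonglongrightarrow> 0" by simp
    then show ?thesis
      by (rule tendsto_sandwich[OF _ _ tendsto_const, rotated 2])
        (use le in \<open>simp_all add: channel_prob_nonneg\<close>)
  next
    case False
    \<comment> \<open>The constants tend to \<open>b > 0\<close> and the weight of \<open>l\<close>
      to 0, so the quotient eventually exceeds 1 and the probability is cut off at 0.\<close>
    have "\<theta> l = 0" using l th(1) by (force simp: P_def)
    then have "(\<lambda>n. a (r n) - w (r n) l) \<longlonglongrightarrow> b"
      using tendsto_diff[OF ar wr[of l]] l by simp
    then have "\<forall>\<^sub>F n in sequentially. a (r n) - w (r n) l > 0"
      using False b0 by (intro order_tendstoD(1)) auto
    then have "\<forall>\<^sub>F n in sequentially. ?p n l = 0"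
    proof eventually_elim
      case (elim n)
      have "1 \<le> (a (r n) / w (r n) l) powr (1 / (real K - 1))"
        using elim K l wpos[of l "r n"] by (intro ge_one_powr_ge_zero) auto
      then show ?case by (simp add: channel_prob_def)
    qed
    then show ?thesis by (rule tendsto_eventually)
  qed
  have lim: "(\<lambda>n. ?p n l) \<longlonglongrightarrow> channel_prob K b \<theta> l" if l: "l \<in> {1..N}" for l
  proof (cases "l \<in> P")
    case False
    then have "channel_prob K b \<theta> l = 0" using l by (simp add: P_def channel_prob_def)
    then show ?thesis using limZ[of l] l False by simp
  qed (rule limP)
  have "(\<lambda>n. \<Sum>l=1..N. ?p n l) \<longlonglongrightarrow> (\<Sum>l=1..N. channel_prob K b \<theta> l)"
    using lim by (intro tendsto_sum) auto
  then have "(\<Sum>l=1..N. channel_prob K b \<theta> l) = 1"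
    unfolding a1 by (simp add: LIMSEQ_const_iff)
  then have nb: "normalizing K N \<theta> b" using b0 by (simp add: normalizing_def)
  have "normalized_prob K N (w (r n)) i = ?p n i" for n
    by (rule normalized_prob_eq[OF K i a])
  then show ?thesis
    using lim[OF i] r(1) by (auto simp: normalized_prob_eq[OF K i nb])
qed

text \<open>If no \<delta> worked, the radii \<open>1 / (n + 1)\<close> would yield positive weights
  converging to \<theta> whose values all stay more than \<epsilon> away, contradicting convergence
  along a subsequence. Only positive weights are considered, since the estimates are always
  positive.\<close>

lemma normalized_prob_continuous:
  assumes K: "K > 1" and i: "i \<in> {1..N}"
    and th: "\<forall>l\<in>{1..N}. \<theta> l \<ge> 0" "\<exists>l\<in>{1..N}. \<theta> l > 0" and e: "\<epsilon> > 0"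
  obtains \<delta> where "\<delta> > 0"
    "\<And>w. (\<And>l. l \<in> {1..N} \<Longrightarrow> w l > 0 \<and> \<bar>w l - \<theta> l\<bar> < \<delta>) \<Longrightarrow>
       \<bar>normalized_prob K N w i - normalized_prob K N \<theta> i\<bar> \<le> \<epsilon>"
proof (rule ccontr)
  assume neg: "\<not> thesis"
  have "\<exists>w. (\<forall>l\<in>{1..N}. w l > 0 \<and> \<bar>w l - \<theta> l\<bar> < 1 / real (Suc n)) \<and>
      \<bar>normalized_prob K N w i - normalized_prob K N \<theta> i\<bar> > \<epsilon>" for n
  proof (rule ccontr)
    assume "\<not> ?thesis"
    then show False
      using neg that[of "1 / real (Suc n)"] by (force simp: not_less)
  qed
  then obtain w where w: "\<And>n l. l \<in> {1..N} \<Longrightarrow> w n l > 0"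
      "\<And>n l. l \<in> {1..N} \<Longrightarrow> \<bar>w n l - \<theta> l\<bar> < 1 / real (Suc n)"
    and far: "\<And>n. \<bar>normalized_prob K N (w n) i - normalized_prob K N \<theta> i\<bar> > \<epsilon>"
    by metis
  have "(\<lambda>n. w n l) \<longlonglongrightarrow> \<theta> l" if "l \<in> {1..N}" for l
  proof (rule LIM_zero_cancel, rule Lim_null_comparison)
    show "\<forall>\<^sub>F n in sequentially. norm (w n l - \<theta> l) \<le> 1 / real (Suc n)"
      using w(2)[OF that] by (intro always_eventually) (auto simp: less_imp_le simp del: of_nat_Suc)
    show "(\<lambda>n. 1 / real (Suc n)) \<longlonglongrightarrow> 0" by (rule LIMSEQ_Suc[OF lim_1_over_n])
  qed
  then obtain r where "(\<lambda>n. normalized_prob K N (w (r n)) i) \<longlonglongrightarrow> normalized_prob K N \<theta> i"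
    using normalized_prob_tendsto[of K i N \<theta> w] K i th w(1) by blast
  then have "\<forall>\<^sub>F n in sequentially. dist (normalized_prob K N (w (r n)) i) (normalized_prob K N \<theta> i) < \<epsilon>"
    using e by (rule tendstoD)
  then show False
    using far by (auto simp: dist_real_def eventually_sequentially dest: less_asym)
qed

section \<open>Hoeffding's bound and a two-valued integral\<close>

text \<open>Hoeffding's lemma for a centred Bernoulli variable. For \<open>s \<ge> 0\<close>,
  factoring out \<open>exp (- s * p)\<close> and taking the logarithm leads to
  \<open>Hoeffdings_lemma_aux\<close>; negative \<open>s\<close> is reduced to this by exchanging
  the two outcomes.\<close>

lemma bernoulli_exp_le:
  fixes p s :: real
  assumes "0 \<le> p" "p \<le> 1"
  shows "p * exp (s * (1 - p)) + (1 - p) * exp (- s * p) \<le> exp (s\<^sup>2 / 8)"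
proof -
  have main: "p * exp (s * (1 - p)) + (1 - p) * exp (- s * p) \<le> exp (s\<^sup>2 / 8)"
    if s: "s \<ge> 0" and p: "0 \<le> p" "p \<le> 1" for p s :: real
  proof -
    have pos: "1 + p * (exp s - 1) > 0" using s p by (intro add_pos_nonneg) auto
    have "p * exp (s * (1 - p)) + (1 - p) * exp (- s * p) = exp (- s * p) * (1 + p * (exp s - 1))"
    proof -
      have "exp (s * (1 - p)) = exp (- s * p) * exp s"
        by (simp add: right_diff_distrib flip: exp_add)
      then show ?thesis by (simp only: algebra_simps)
    qed
    also have "\<dots> = exp (- s * p + ln (1 + p * (exp s - 1)))"
      using pos by (simp only: exp_add exp_ln)
    also have "\<dots> \<le> exp (s\<^sup>2 / 8)"
      using Hoeffdings_lemma_aux[OF s p(1)] by simp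
    finally show ?thesis .
  qed
  show ?thesis
    using main[of s p] main[of "- s" "1 - p"] assms by (cases "s \<ge> 0") auto
qed

lemma nn_integral_pmf_if:
  fixes p :: "'a pmf"
  assumes "A \<ge> 0" "B \<ge> 0"
  shows "(\<integral>\<^sup>+ a. ennreal (if a = i then A else B) \<partial>p) = ennreal (A * pmf p i + B * (1 - pmf p i))"
proof -
  have "(\<integral>\<^sup>+ a. ennreal (if a = i then A else B) \<partial>p) =
      (\<integral>\<^sup>+ a. ennreal A * indicator {i} a + ennreal B * indicator (- {i}) a \<partial>p)"
    by (intro nn_integral_cong) auto
  also have "\<dots> = ennreal A * emeasure p {i} + ennreal B * emeasure p (- {i})"
    by (simp add: nn_integral_add nn_integral_cmult_indicator)
  also have "\<dots> = ennreal (A * pmf p i + B * (1 - pmf p i))"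
  proof -
    have "emeasure p (- {i}) = ennreal (1 - pmf p i)"
      using measure_pmf.prob_compl[of "{i}" p]
      by (simp add: measure_pmf.emeasure_eq_measure pmf.rep_eq Compl_eq_Diff_UNIV)
    then show ?thesis
      using assms pmf_le_1[of p i] by (simp add: emeasure_pmf_single ennreal_mult ennreal_plus)
  qed
  finally show ?thesis .
qed

section \<open>Counts and path laws when one slot is appended\<close>

lemma Y_fun_upd: "j \<le> Suc m \<Longrightarrow> Y (h(Suc m := s)) u l j = Y h u l j"
  unfolding Y_def by (rule arg_cong[of _ _ card]) (auto simp: sensed_def)

lemma X_fun_upd: "j \<le> Suc m \<Longrightarrow> X N (h(Suc m := s)) u l j = X N h u l j"
  unfolding X_def by (rule arg_cong[of _ _ "\<lambda>A. 1 + card A"]) (auto simp: sensed_def free_def)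

lemma Y_fun_upd_Suc:
  "Y (h(Suc m := s)) u l (Suc (Suc m)) = Y h u l (Suc m) + (if fst s u = l then 1 else 0)"
proof -
  have "{t \<in> {1..<Suc (Suc m)}. sensed (h(Suc m := s)) u t = l} =
      {t \<in> {1..<Suc m}. sensed h u t = l} \<union> (if fst s u = l then {Suc m} else {})"
    by (auto simp: sensed_def less_Suc_eq split: if_splits)
  then show ?thesis by (simp add: Y_def card_Un_disjoint)
qed

lemma X_fun_upd_Suc:
  assumes "N \<le> m"
  shows "X N (h(Suc m := s)) u l (Suc (Suc m)) =
    X N h u l (Suc m) + (if fst s u = l \<and> snd s l then 1 else 0)"
proof -
  have "{t \<in> {N<..<Suc (Suc m)}. sensed (h(Suc m := s)) u t = l \<and> free (h(Suc m := s)) l t} =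
      {t \<in> {N<..<Suc m}. sensed h u t = l \<and> free h l t} \<union>
      (if fst s u = l \<and> snd s l then {Suc m} else {})"
    using assms by (auto simp: sensed_def free_def less_Suc_eq split: if_splits)
  then show ?thesis by (simp add: X_def card_Un_disjoint)
qed

text \<open>Each further slot integrates a constant against a probability measure. This passes from
  the law up to the horizon to the law of the slots that precede \<open>j\<close>.\<close>

lemma nn_integral_path_pmf_truncate:
  fixes f :: "path \<Rightarrow> ennreal"
  assumes "\<And>n h s. m \<le> n \<Longrightarrow> f (h(Suc n := s)) = f h" and "m \<le> M"
  shows "(\<integral>\<^sup>+ h. f h \<partial>path_pmf K N \<theta> \<sigma> T M) = (\<integral>\<^sup>+ h. f h \<partial>path_pmf K N \<theta> \<sigma> T m)"
  using assms(2)
proof (induction M rule: dec_induct)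
  case (step n)
  then show ?case using assms(1) by (simp add: measure_pmf.emeasure_space_1)
qed simp

section \<open>Bounds on counts and sensing probabilities along possible paths\<close>

locale two_phase_rule =
  fixes K N :: nat and \<theta> :: "nat \<Rightarrow> real" and \<sigma> :: "nat \<Rightarrow> nat \<Rightarrow> nat"
  assumes K: "K > 1" and N: "N > 0"
    and theta: "l \<in> {1..N} \<Longrightarrow> 0 \<le> \<theta> l \<and> \<theta> l \<le> 1"
    and sigma: "u \<in> {1..K} \<Longrightarrow> bij_betw (\<sigma> u) {1..N} {1..N}"
begin

text \<open>During initialization the premise of \<open>pmf_sense_prob\<close> on \<open>Y\<close>
  is vacuous, so no circularity arises: the choice has nonzero \<open>sense_prob\<close>, which in
  slot \<open>t\<close> is a point mass at \<open>\<sigma> u t\<close>.\<close>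

lemma sensed_initial:
  assumes "h \<in> set_pmf (path_pmf K N \<theta> \<sigma> T m)" "u \<in> {1..K}" "t \<in> {1..N}" "t \<le> m"
  shows "sensed h u t = \<sigma> u t"
  using assms(1,4)
proof (induction m arbitrary: h)
  case (Suc m)
  then obtain g s where g: "g \<in> set_pmf (path_pmf K N \<theta> \<sigma> T m)"
    and s: "s \<in> set_pmf (slot_pmf K N \<theta> \<sigma> T g (Suc m))" and h: "h = g(Suc m := s)"
    by auto
  show ?case
  proof (cases "t = Suc m")
    case True
    have "fst s \<in> set_pmf (Pi_pmf {1..K} 0 (\<lambda>u. embed_pmf (sense_prob K N \<sigma> T g u (Suc m))))"
      using s by (auto simp: slot_pmf_def)
    then have "fst s u \<in> set_pmf (embed_pmf (sense_prob K N \<sigma> T g u (Suc m)))"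
      using assms(2) by (auto simp: set_Pi_pmf PiE_dflt_def)
    moreover have "pmf (embed_pmf (sense_prob K N \<sigma> T g u (Suc m))) (fst s u) =
        sense_prob K N \<sigma> T g u (Suc m) (fst s u)"
      using K N True assms(2,3) bij_betwE[OF sigma[OF assms(2)]] by (intro pmf_sense_prob) auto
    ultimately have "sense_prob K N \<sigma> T g u (Suc m) (fst s u) \<noteq> 0"
      by (simp add: set_pmf_iff)
    then show ?thesis
      using True assms(3) by (simp add: h sensed_def sense_prob_def split: if_splits)
  next
    case False
    then show ?thesis using Suc.IH[OF g] Suc.prems(2) by (simp add: h sensed_def)
  qed
qed (use assms(3) in auto)

text \<open>As \<open>\<sigma> u\<close> is a permutation, initialization contributes exactly one
  sensing of each channel. The resulting summand 1 matches the one in \<open>X\<close>, so the two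
  counts can be compared slot by slot after \<open>N\<close>.\<close>

lemma Y_eq:
  assumes "h \<in> set_pmf (path_pmf K N \<theta> \<sigma> T m)" "u \<in> {1..K}" "l \<in> {1..N}" "N \<le> m" "N < j"
  shows "Y h u l j = 1 + card {t \<in> {N<..<j}. sensed h u t = l}"
proof -
  have init: "sensed h u t = \<sigma> u t" if "t \<in> {1..N}" for t
    using sensed_initial[OF assms(1,2) that] that assms(4) by simp
  have inj: "inj_on (\<sigma> u) {1..N}"
    using sigma[OF assms(2)] by (rule bij_betw_imp_inj_on)
  have "l \<in> \<sigma> u ` {1..N}"
    unfolding bij_betw_imp_surj_on[OF sigma[OF assms(2)]] by (rule assms(3))
  then obtain t0 where t0: "t0 \<in> {1..N}" "\<sigma> u t0 = l" by (elim imageE) simp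
  have t0_unique: "t = t0" if "t \<in> {1..N}" "sensed h u t = l" for t
    by (rule inj_onD[OF inj _ that(1) t0(1)]) (use that init t0 in simp)
  have "{t \<in> {1..<j}. sensed h u t = l} = insert t0 {t \<in> {N<..<j}. sensed h u t = l}"
  proof (rule set_eqI)
    fix t
    have "sensed h u t0 = l" "1 \<le> t0" "t0 < j"
      using t0 init[OF t0(1)] assms(5) by auto
    then show "t \<in> {t \<in> {1..<j}. sensed h u t = l} \<longleftrightarrow>
        t \<in> insert t0 {t \<in> {N<..<j}. sensed h u t = l}"
      using t0_unique[of t] by (cases "t \<le> N") auto
  qed
  moreover have "t0 \<notin> {t \<in> {N<..<j}. sensed h u t = l}" using t0 by simp
  ultimately have "card {t \<in> {1..<j}. sensed h u t = l} = 1 + card {t \<in> {N<..<j}. sensed h u t = l}"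
    by simp
  then show ?thesis by (simp add: Y_def)
qed

lemma counts_bounds:
  assumes "h \<in> set_pmf (path_pmf K N \<theta> \<sigma> T m)" "u \<in> {1..K}" "l \<in> {1..N}" "N \<le> m" "N < j"
  shows "1 \<le> Y h u l j" "1 \<le> X N h u l j" "X N h u l j \<le> Y h u l j" "Y h u l j \<le> j"
proof -
  note Y = Y_eq[OF assms]
  show "1 \<le> Y h u l j" "1 \<le> X N h u l j" by (simp_all add: Y X_def)
  show "X N h u l j \<le> Y h u l j" unfolding Y X_def by (intro add_left_mono card_mono) auto
  have "Y h u l j \<le> card {1..<j}" unfolding Y_def by (intro card_mono) auto
  then show "Y h u l j \<le> j" by simp
qed

text \<open>The point of this bound is that it does not depend on the path: the decay of the mean
  potential becomes deterministic, and its sum over slots is harmonic.\<close>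

lemma sense_prob_first_phase:
  assumes "h \<in> set_pmf (path_pmf K N \<theta> \<sigma> T m)" "u \<in> {1..K}" "l \<in> {1..N}" "N \<le> m" "N < j"
    and "real j < ln (real T)"
  shows "1 / (real N * real j) \<le> sense_prob K N \<sigma> T h u j l"
proof -
  let ?t = "\<lambda>l. theta_hat N h u l j"
  have t: "1 / real j \<le> ?t l" "?t l \<le> 1" if l: "l \<in> {1..N}" for l
  proof -
    note b = counts_bounds[OF assms(1,2) l assms(4,5)]
    show "1 / real j \<le> ?t l" unfolding theta_hat_def using b by (intro frac_le) auto
    show "?t l \<le> 1" unfolding theta_hat_def using b by simp
  qed
  have j: "1 / real j > 0" using assms(5) by simp
  have "(\<Sum>l=1..N. ?t l) \<le> (\<Sum>l=1..N. 1)" using t(2) by (intro sum_mono) auto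
  moreover have "?t l > 0" if "l \<in> {1..N}" for l
    using t(1)[OF that] j by linarith
  then have "(\<Sum>l=1..N. ?t l) > 0"
    using N by (intro sum_pos) auto
  ultimately have "1 / real j / real N \<le> ?t l / (\<Sum>l=1..N. ?t l)"
    using t(1)[OF assms(3)] j by (intro frac_le) (auto simp: theta_hat_def)
  then show ?thesis using assms(3,5,6) by (simp add: sense_prob_def mult.commute)
qed

text \<open>Projecting a slot to one user's choice and one channel's state gives a product law,
  because users and channels are drawn independently; the remaining coordinates integrate
  out.\<close>

lemma nn_integral_slot_pmf:
  fixes f :: "nat \<Rightarrow> bool \<Rightarrow> ennreal"
  assumes "u \<in> {1..K}" "l \<in> {1..N}"
  shows "(\<integral>\<^sup>+ s. f (fst s u) (snd s l) \<partial>slot_pmf K N \<theta> \<sigma> T h j) =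
    (\<integral>\<^sup>+ a. f a True * \<theta> l + f a False * (1 - \<theta> l) \<partial>embed_pmf (sense_prob K N \<sigma> T h u j))"
proof -
  let ?g = "\<lambda>(a, b). (a u, b l)"
  have "map_pmf ?g (slot_pmf K N \<theta> \<sigma> T h j) =
      pair_pmf (embed_pmf (sense_prob K N \<sigma> T h u j)) (bernoulli_pmf (\<theta> l))"
    unfolding slot_pmf_def map_pair using assms by (simp add: Pi_pmf_component)
  moreover have "(\<integral>\<^sup>+ s. f (fst s u) (snd s l) \<partial>slot_pmf K N \<theta> \<sigma> T h j) =
      (\<integral>\<^sup>+ s. f (fst s) (snd s) \<partial>map_pmf ?g (slot_pmf K N \<theta> \<sigma> T h j))"
    by (simp add: case_prod_beta)
  ultimately show ?thesis
    using theta[OF assms(2)] by (simp add: nn_integral_pair_pmf')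
qed

section \<open>The exponential potential and its decay\<close>

text \<open>Hoeffding's lemma consumes half of the penalty \<open>s^2 / 4\<close> per sensing; the
  other half remains as a strict decay factor \<open>exp (- s^2 / 8)\<close>.\<close>

definition potential :: "real \<Rightarrow> nat \<Rightarrow> nat \<Rightarrow> path \<Rightarrow> nat \<Rightarrow> real" where
  "potential s u l h j =
     exp (s * (real (X N h u l j) - \<theta> l * real (Y h u l j)) - s\<^sup>2 / 4 * real (Y h u l j))"

text \<open>A lower bound for the loss in the exponent of the mean potential in slot
  \<open>t\<close>: one minus the decay factor, times the bound on the sensing probability. In the
  second phase only monotonicity is claimed, hence 0.\<close>

definition rate :: "real \<Rightarrow> nat \<Rightarrow> nat \<Rightarrow> real" where
  "rate s T t = (if real t < ln (real T) then (1 - exp (- s\<^sup>2 / 8)) / (real N * real t) else 0)"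

text \<open>Given the past, the potential is multiplied in mean by at most \<rho> if the channel is
  sensed and by 1 otherwise. With sensing probability \<open>p\<close> this gives the factor
  \<open>1 - p * (1 - \<rho>)\<close>, which is at most
  \<open>exp (- (p * (1 - \<rho>)))\<close>.\<close>

lemma potential_step:
  assumes h: "h \<in> set_pmf (path_pmf K N \<theta> \<sigma> T m)" and u: "u \<in> {1..K}" and l: "l \<in> {1..N}"
    and m: "N \<le> m"
  shows "(\<integral>\<^sup>+ x. potential s u l (h(Suc m := x)) (Suc (Suc m)) \<partial>slot_pmf K N \<theta> \<sigma> T h (Suc m))
    \<le> ennreal (exp (- rate s T (Suc m))) * ennreal (potential s u l h (Suc m))"
proof -
  define W where "W = potential s u l h (Suc m)"
  define \<rho> where "\<rho> = exp (- s\<^sup>2 / 8)"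
  define p where "p = pmf (embed_pmf (sense_prob K N \<sigma> T h u (Suc m))) l"
  define f where "f = (\<lambda>a b. W * (if a = l then exp (s * (of_bool b - \<theta> l) - s\<^sup>2 / 4) else 1))"
  have W: "W > 0" by (simp add: W_def potential_def)
  have rho: "0 < \<rho>" "\<rho> \<le> 1" by (simp_all add: \<rho>_def)
  have "potential s u l (h(Suc m := x)) (Suc (Suc m)) = f (fst x u) (snd x l)" for x
    unfolding potential_def Y_fun_upd_Suc X_fun_upd_Suc[OF m] f_def W_def
    by (auto simp: algebra_simps simp flip: exp_add)
  then have "(\<integral>\<^sup>+ x. potential s u l (h(Suc m := x)) (Suc (Suc m)) \<partial>slot_pmf K N \<theta> \<sigma> T h (Suc m))
     = (\<integral>\<^sup>+ a. ennreal (f a True) * \<theta> l + ennreal (f a False) * (1 - \<theta> l)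
          \<partial>embed_pmf (sense_prob K N \<sigma> T h u (Suc m)))"
    using nn_integral_slot_pmf[OF u l, where f = "\<lambda>a b. ennreal (f a b)"] by simp
  also have "\<dots> \<le> (\<integral>\<^sup>+ a. ennreal (if a = l then W * \<rho> else W)
          \<partial>embed_pmf (sense_prob K N \<sigma> T h u (Suc m)))"
  proof (rule nn_integral_mono)
    fix a
    have f0: "f a b \<ge> 0" for b using W by (simp add: f_def)
    have "ennreal (f a True) * \<theta> l + ennreal (f a False) * (1 - \<theta> l) =
        ennreal (f a True * \<theta> l + f a False * (1 - \<theta> l))"
      using theta[OF l] f0 by (simp add: ennreal_mult ennreal_plus)
    also have "f a True * \<theta> l + f a False * (1 - \<theta> l) \<le> (if a = l then W * \<rho> else W)"
    proof (cases "a = l")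
      case True
      have e: "exp (x - s\<^sup>2 / 4) = exp (- s\<^sup>2 / 4) * exp x" for x
        by (simp flip: exp_add)
      have "f a True = W * (exp (- s\<^sup>2 / 4) * exp (s * (1 - \<theta> l)))"
        unfolding f_def e using True by simp
      moreover have "f a False = W * (exp (- s\<^sup>2 / 4) * exp (- s * \<theta> l))"
        unfolding f_def e using True by simp
      ultimately have "f a True * \<theta> l + f a False * (1 - \<theta> l) = W * exp (- s\<^sup>2 / 4) *
          (\<theta> l * exp (s * (1 - \<theta> l)) + (1 - \<theta> l) * exp (- s * \<theta> l))"
        by (simp only: algebra_simps)
      also have "\<dots> \<le> W * exp (- s\<^sup>2 / 4) * exp (s\<^sup>2 / 8)"
        using W theta[OF l] by (intro mult_left_mono bernoulli_exp_le) auto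
      also have "\<dots> = W * \<rho>" by (simp add: \<rho>_def flip: exp_add)
      finally show ?thesis using True by simp
    qed (simp add: f_def algebra_simps)
    finally show "ennreal (f a True) * \<theta> l + ennreal (f a False) * (1 - \<theta> l) \<le>
        ennreal (if a = l then W * \<rho> else W)" by (simp add: ennreal_leI)
  qed
  also have "\<dots> = ennreal (W * (1 - p * (1 - \<rho>)))"
    using W rho by (subst nn_integral_pmf_if) (auto simp: p_def algebra_simps)
  also have "\<dots> \<le> ennreal (W * exp (- rate s T (Suc m)))"
  proof -
    have "p = sense_prob K N \<sigma> T h u (Suc m) l"
      unfolding p_def using K N m counts_bounds(1)[OF h u _ m]
      by (intro pmf_sense_prob) (auto simp: Suc_le_eq)
    moreover have "p \<ge> 0" by (simp add: p_def)
    \<comment> \<open>In the first phase this is the lower bound on \<open>p\<close>; in the second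
      phase the left side is 0 and \<open>p \<ge> 0\<close> suffices.\<close>
    ultimately have "rate s T (Suc m) \<le> p * (1 - \<rho>)"
      using rho sense_prob_first_phase[OF h u l m, of "Suc m"] m mult_nonneg_nonneg[of p "1 - \<rho>"]
        mult_right_mono[of "1 / (real N * real (Suc m))" p "1 - \<rho>"]
      by (auto simp: rate_def \<rho>_def p_def)
    moreover have "1 - p * (1 - \<rho>) \<le> exp (- (p * (1 - \<rho>)))"
      using exp_ge_add_one_self[of "- (p * (1 - \<rho>))"] by simp
    moreover have "exp (- (p * (1 - \<rho>))) \<le> exp (- rate s T (Suc m))"
      using calculation(1) by simp
    ultimately have "1 - p * (1 - \<rho>) \<le> exp (- rate s T (Suc m))"
      by linarith
    then show ?thesis using W by (intro ennreal_leI mult_left_mono) auto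
  qed
  also have "\<dots> = ennreal (exp (- rate s T (Suc m))) * ennreal W"
    using W by (subst mult.commute) (simp add: ennreal_mult)
  finally show ?thesis by (simp only: W_def)
qed

text \<open>Induction by conditioning on the past, which is how \<open>path_pmf\<close> is built.
  The term \<open>\<bar>s\<bar>\<close> bounds the exponent at the end of initialization.\<close>

lemma nn_integral_potential:
  assumes u: "u \<in> {1..K}" and l: "l \<in> {1..N}" and "N \<le> m"
  shows "(\<integral>\<^sup>+ h. potential s u l h (Suc m) \<partial>path_pmf K N \<theta> \<sigma> T m)
    \<le> ennreal (exp (\<bar>s\<bar> - (\<Sum>t\<in>{N<..m}. rate s T t)))"
  using assms(3)
proof (induction m rule: dec_induct)
  case base
  have "(\<integral>\<^sup>+ h. potential s u l h (Suc N) \<partial>path_pmf K N \<theta> \<sigma> T N)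
      \<le> (\<integral>\<^sup>+ h. ennreal (exp \<bar>s\<bar>) \<partial>path_pmf K N \<theta> \<sigma> T N)"
  proof (intro nn_integral_mono_AE AE_pmfI ennreal_leI)
    fix h assume "h \<in> set_pmf (path_pmf K N \<theta> \<sigma> T N)"
    note Y = Y_eq[OF this u l order.refl lessI]
    \<comment> \<open>At the beginning of slot \<open>N + 1\<close> both counts equal 1, as no slot
      lies strictly between \<open>N\<close> and \<open>N + 1\<close>.\<close>
    have none: "{t. N < t \<and> t < Suc N \<and> Q t} = {}" for Q by auto
    have "s * (1 - \<theta> l) - s\<^sup>2 / 4 \<le> \<bar>s\<bar> * (1 - \<theta> l)"
      using theta[OF l] mult_right_mono[of s "\<bar>s\<bar>" "1 - \<theta> l"]
        zero_le_power2[of s] by linarith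
    also have "\<dots> \<le> \<bar>s\<bar> * 1" using theta[OF l] by (intro mult_left_mono) auto
    finally show "potential s u l h (Suc N) \<le> exp \<bar>s\<bar>"
      by (simp add: potential_def Y X_def none)
  qed
  then show ?case by (simp add: measure_pmf.emeasure_space_1)
next
  case (step m)
  have "(\<integral>\<^sup>+ h. potential s u l h (Suc (Suc m)) \<partial>path_pmf K N \<theta> \<sigma> T (Suc m)) =
      (\<integral>\<^sup>+ h. (\<integral>\<^sup>+ x. potential s u l (h(Suc m := x)) (Suc (Suc m))
        \<partial>slot_pmf K N \<theta> \<sigma> T h (Suc m)) \<partial>path_pmf K N \<theta> \<sigma> T m)"
    by simp
  also have "\<dots> \<le> (\<integral>\<^sup>+ h. ennreal (exp (- rate s T (Suc m))) * ennreal (potential s u l h (Suc m))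
      \<partial>path_pmf K N \<theta> \<sigma> T m)"
    using step.hyps by (intro nn_integral_mono_AE AE_pmfI potential_step u l) auto
  also have "\<dots> = ennreal (exp (- rate s T (Suc m))) *
      (\<integral>\<^sup>+ h. potential s u l h (Suc m) \<partial>path_pmf K N \<theta> \<sigma> T m)"
    by (simp add: nn_integral_cmult)
  also have "\<dots> \<le> ennreal (exp (- rate s T (Suc m))) * ennreal (exp (\<bar>s\<bar> - (\<Sum>t\<in>{N<..m}. rate s T t)))"
    by (intro mult_left_mono step.IH) simp
  also have "\<dots> = ennreal (exp (\<bar>s\<bar> - (\<Sum>t\<in>{N<..Suc m}. rate s T t)))"
  proof -
    have "{N<..Suc m} = insert (Suc m) {N<..m}" using step.hyps by auto
    then have "\<bar>s\<bar> - (\<Sum>t\<in>{N<..Suc m}. rate s T t) = - rate s T (Suc m) + (\<bar>s\<bar> - (\<Sum>t\<in>{N<..m}. rate s T t))"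
      by simp
    then show ?thesis by (simp only: exp_add ennreal_mult exp_ge_zero)
  qed
  finally show ?case .
qed

lemma prob_potential_ge_1:
  assumes "u \<in> {1..K}" "l \<in> {1..N}" "N < j" "j \<le> Suc M"
  shows "measure_pmf.prob (path_pmf K N \<theta> \<sigma> T M) {h. potential s u l h j \<ge> 1}
    \<le> exp (\<bar>s\<bar> - (\<Sum>t\<in>{N<..<j}. rate s T t))"
proof -
  define m where "m = j - 1"
  have m: "j = Suc m" "N \<le> m" "m \<le> M" using assms(3,4) by (auto simp: m_def)
  let ?P = "path_pmf K N \<theta> \<sigma> T"
  have "emeasure (?P M) {h. potential s u l h j \<ge> 1} \<le> (\<integral>\<^sup>+ h. potential s u l h j \<partial>?P M)"
    using nn_integral_Markov_inequality[of "\<lambda>h. ennreal (potential s u l h j)" UNIV "?P M" 1]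
    by simp
  \<comment> \<open>The potential at \<open>j\<close> reads only slots before \<open>j\<close>, so
    the law of the first \<open>m = j - 1\<close> slots suffices.\<close>
  also have "\<dots> = (\<integral>\<^sup>+ h. potential s u l h j \<partial>?P m)"
    using m by (intro nn_integral_path_pmf_truncate) (simp_all add: potential_def X_fun_upd Y_fun_upd)
  also have "\<dots> \<le> ennreal (exp (\<bar>s\<bar> - (\<Sum>t\<in>{N<..m}. rate s T t)))"
    unfolding m(1) by (intro nn_integral_potential assms m)
  finally have "emeasure (?P M) {h. potential s u l h j \<ge> 1}
      \<le> ennreal (exp (\<bar>s\<bar> - (\<Sum>t\<in>{N<..m}. rate s T t)))" .
  moreover have "{N<..m} = {N<..<j}" by (auto simp: m(1))
  ultimately show ?thesis
    by (simp add: measure_pmf.emeasure_eq_measure)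
qed

text \<open>The values \<open>s = 4 * \<delta>\<close> and \<open>s = - (4 * \<delta>)\<close> make
  \<open>\<bar>s\<bar> * \<delta>\<close> equal to \<open>s^2 / 4\<close>, so a deviation of
  \<delta> in the matching direction makes the exponent nonnegative. The factor 2 comes from the two
  directions.\<close>

lemma theta_hat_deviation:
  assumes u: "u \<in> {1..K}" and l: "l \<in> {1..N}" and j: "N < j" "j \<le> Suc M" and d: "\<delta> > 0"
  shows "measure_pmf.prob (path_pmf K N \<theta> \<sigma> T M) {h. \<bar>theta_hat N h u l j - \<theta> l\<bar> \<ge> \<delta>}
    \<le> 2 * exp (4 * \<delta> - (\<Sum>t\<in>{N<..<j}. rate (4 * \<delta>) T t))"
proof -
  let ?P = "path_pmf K N \<theta> \<sigma> T M"
  have rate: "rate (- s) T t = rate s T t" for s t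
    by (simp only: rate_def power2_minus)
  let ?E = "\<lambda>s. {h. potential s u l h j \<ge> 1}"
  have "measure_pmf.prob ?P {h. \<bar>theta_hat N h u l j - \<theta> l\<bar> \<ge> \<delta>}
      \<le> measure_pmf.prob ?P (?E (4 * \<delta>) \<union> ?E (- (4 * \<delta>)))"
  proof (intro measure_pmf.finite_measure_mono_AE AE_pmfI impI)
    fix h assume h: "h \<in> set_pmf ?P" and dev: "h \<in> {h. \<bar>theta_hat N h u l j - \<theta> l\<bar> \<ge> \<delta>}"
    have y: "real (Y h u l j) > 0"
      using counts_bounds(1)[OF h u l _ j(1)] j by simp
    then have "real (X N h u l j) = theta_hat N h u l j * real (Y h u l j)"
      by (simp add: theta_hat_def)
    then have x: "real (X N h u l j) - \<theta> l * real (Y h u l j) =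
        (theta_hat N h u l j - \<theta> l) * real (Y h u l j)"
      by (simp add: algebra_simps)
    \<comment> \<open>The exponent is a multiple of \<open>Y\<close>, so its sign is decided by the
      estimate alone, however large the random count is.\<close>
    have pot: "potential s u l h j = exp ((s * (theta_hat N h u l j - \<theta> l) - s\<^sup>2 / 4) * real (Y h u l j))" for s
      unfolding potential_def x by (simp add: algebra_simps)
    consider "theta_hat N h u l j - \<theta> l \<ge> \<delta>" | "\<theta> l - theta_hat N h u l j \<ge> \<delta>"
      using dev by fastforce
    then show "h \<in> ?E (4 * \<delta>) \<union> ?E (- (4 * \<delta>))"
    proof cases
      case 1
      then have "4 * \<delta> * (theta_hat N h u l j - \<theta> l) - (4 * \<delta>)\<^sup>2 / 4 \<ge> 0"
        using d by (simp add: power2_eq_square)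
      then have "potential (4 * \<delta>) u l h j \<ge> 1" using y unfolding pot by simp
      then show ?thesis by simp
    next
      case 2
      then have "- (4 * \<delta>) * (theta_hat N h u l j - \<theta> l) - (- (4 * \<delta>))\<^sup>2 / 4 \<ge> 0"
        using d mult_left_mono[OF 2, of "4 * \<delta>"] by (simp add: power2_eq_square algebra_simps)
      then have "potential (- (4 * \<delta>)) u l h j \<ge> 1" using y unfolding pot by simp
      then show ?thesis by simp
    qed
  qed auto
  also have "\<dots> \<le> measure_pmf.prob ?P (?E (4 * \<delta>)) + measure_pmf.prob ?P (?E (- (4 * \<delta>)))"
    by (intro measure_Un_le) auto
  also have "\<dots> \<le> 2 * exp (4 * \<delta> - (\<Sum>t\<in>{N<..<j}. rate (4 * \<delta>) T t))"
    using prob_potential_ge_1[OF u l j, of T "4 * \<delta>"] prob_potential_ge_1[OF u l j, of T "- (4 * \<delta>)"] d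
    by (simp add: rate)
  finally show ?thesis .
qed

section \<open>Divergence of the total rate and consistency of the estimates\<close>

text \<open>All first-phase slots lie before \<open>j T\<close>. Those after \<open>N\<close>
  contribute a fixed multiple of a tail of the harmonic sum up to about \<open>ln T\<close>, which
  is unbounded in \<open>T\<close>.\<close>

lemma sum_rate_at_top:
  assumes s: "s \<noteq> 0" and j: "\<And>T. T \<ge> 1 \<Longrightarrow> ln (real T) \<le> real (j T)"
  shows "filterlim (\<lambda>T. \<Sum>t\<in>{N<..<j T}. rate s T t) at_top sequentially"
proof -
  define c where "c = (1 - exp (- s\<^sup>2 / 8)) / real N"
  \<comment> \<open>For \<open>T \<ge> 1\<close> this is the largest natural number below
    \<open>ln T\<close>, that is, the last slot of the first phase; it is 0 if there is
    none.\<close>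
  define n where "n = (\<lambda>T::nat. nat \<lceil>ln (real T)\<rceil> - 1)"
  have c: "c > 0" using s N by (simp add: c_def)
  have ln_top: "filterlim (\<lambda>T. ln (real T)) at_top sequentially"
    by (rule filterlim_compose[OF ln_at_top filterlim_real_sequentially])
  have lim_n: "filterlim n at_top sequentially"
  proof (subst filterlim_at_top, rule allI)
    fix Z
    have "\<forall>\<^sub>F T in sequentially. ln (real T) > real Z"
      using ln_top by (simp add: filterlim_at_top_dense)
    then show "\<forall>\<^sub>F T in sequentially. Z \<le> n T"
      by eventually_elim (simp add: n_def, linarith)
  qed
  have "filterlim (\<lambda>T. harm (n T) :: real) at_top sequentially"
    by (rule filterlim_compose[OF harm_at_top lim_n])
  then have "filterlim (\<lambda>T. - harm N + (harm (n T) :: real)) at_top sequentially"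
    by (rule filterlim_tendsto_add_at_top[OF tendsto_const])
  then have lim: "filterlim (\<lambda>T. c * (- harm N + harm (n T))) at_top sequentially"
    by (rule filterlim_tendsto_pos_mult_at_top[OF tendsto_const c])
  show ?thesis
  proof (rule filterlim_at_top_mono[OF lim])
    show "\<forall>\<^sub>F T in sequentially. c * (- harm N + harm (n T)) \<le> (\<Sum>t\<in>{N<..<j T}. rate s T t)"
      using eventually_ge_at_top[of 1]
    proof eventually_elim
      case (elim T)
      have lt: "t \<le> n T \<longleftrightarrow> real t < ln (real T)" if "t \<ge> 1" for t
        using that elim unfolding n_def by linarith
      have "harm (n T) - harm N \<le> (\<Sum>t\<in>{N<..n T}. 1 / real t)"
      proof -
        have harm: "harm m = (\<Sum>t\<in>{1..m}. 1 / real t)" for m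
          by (simp add: harm_def inverse_eq_divide)
        \<comment> \<open>Only an inequality, since \<open>n T\<close> may be smaller than
          \<open>N\<close>.\<close>
        have "harm (n T) \<le> (\<Sum>t\<in>{1..N} \<union> {N<..n T}. 1 / real t)"
          unfolding harm by (rule sum_mono2) auto
        also have "\<dots> = harm N + (\<Sum>t\<in>{N<..n T}. 1 / real t)"
          unfolding harm by (rule sum.union_disjoint) auto
        finally show ?thesis by simp
      qed
      then have "c * (harm (n T) - harm N) \<le> c * (\<Sum>t\<in>{N<..n T}. 1 / real t)"
        using c by (intro mult_left_mono) auto
      also have "\<dots> = (\<Sum>t\<in>{N<..n T}. rate s T t)"
        unfolding sum_distrib_left using lt by (intro sum.cong) (auto simp: rate_def c_def)
      also have "\<dots> \<le> (\<Sum>t\<in>{N<..<j T}. rate s T t)"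
      proof (rule sum_mono2)
        show "{N<..n T} \<subseteq> {N<..<j T}"
        proof
          fix t assume t: "t \<in> {N<..n T}"
          then have "real t < real (j T)" using lt[of t] j[OF elim] by simp
          then show "t \<in> {N<..<j T}" using t by simp
        qed
      qed (auto simp: rate_def)
      finally show ?case by simp
    qed
  qed
qed

lemma theta_hat_tendsto_in_prob:
  assumes u: "u \<in> {1..K}" and l: "l \<in> {1..N}" and d: "\<delta> > 0"
    and j: "\<And>T. T \<ge> 1 \<Longrightarrow> ln (real T) \<le> real (j T) \<and> j T \<le> T"
  shows "(\<lambda>T. measure_pmf.prob (path_pmf K N \<theta> \<sigma> T T)
    {h. \<bar>theta_hat N h u l (j T) - \<theta> l\<bar> \<ge> \<delta>}) \<longlonglongrightarrow> 0"
proof (rule tendsto_sandwich[OF _ _ tendsto_const])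
  let ?S = "\<lambda>T. \<Sum>t\<in>{N<..<j T}. rate (4 * \<delta>) T t"
  have "filterlim ?S at_top sequentially"
    using d j by (intro sum_rate_at_top) auto
  then have "filterlim (\<lambda>T. - (4 * \<delta>) + ?S T) at_top sequentially"
    by (rule filterlim_tendsto_add_at_top[OF tendsto_const])
  then have "filterlim (\<lambda>T. 4 * \<delta> - ?S T) at_bot sequentially"
    by (simp add: filterlim_uminus_at_top)
  then have "(\<lambda>T. exp (4 * \<delta> - ?S T)) \<longlonglongrightarrow> 0"
    by (rule filterlim_compose[OF exp_at_bot])
  then show "(\<lambda>T. 2 * exp (4 * \<delta> - ?S T)) \<longlonglongrightarrow> 0"
    by (rule tendsto_mult_right_zero)
  \<comment> \<open>Once \<open>ln T\<close> exceeds \<open>N\<close>, slot \<open>j T\<close> lies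
    beyond the initialization and the deviation bound applies.\<close>
  have "\<forall>\<^sub>F T in sequentially. ln (real T) > real N"
    using filterlim_compose[OF ln_at_top filterlim_real_sequentially] by (auto simp: filterlim_at_top_dense)
  then show "\<forall>\<^sub>F T in sequentially. measure_pmf.prob (path_pmf K N \<theta> \<sigma> T T)
    {h. \<bar>theta_hat N h u l (j T) - \<theta> l\<bar> \<ge> \<delta>} \<le> 2 * exp (4 * \<delta> - ?S T)"
    using eventually_ge_at_top[of 1]
  proof eventually_elim
    case (elim T)
    then have "N < j T" "j T \<le> Suc T" using j[of T] by auto
    then show ?case by (rule theta_hat_deviation[OF u l _ _ d])
  qed
qed auto

end

section \<open>Convergence of the sensing distribution\<close>

theorem lemma10:
  fixes K N :: nat and \<theta> :: "nat \<Rightarrow> real" and \<sigma> :: "nat \<Rightarrow> nat \<Rightarrow> nat"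
    and j :: "nat \<Rightarrow> nat" and k i :: nat and \<epsilon> :: real
  assumes "K > 1"
    and "\<forall>l\<in>{1..N}. 0 \<le> \<theta> l \<and> \<theta> l \<le> 1"
    and "\<exists>l\<in>{1..N}. \<theta> l \<noteq> 0"
    and "\<forall>u\<in>{1..K}. bij_betw (\<sigma> u) {1..N} {1..N}"
    and "\<forall>T\<ge>1. 1 \<le> j T \<and> ln (real T) \<le> real (j T) \<and> j T \<le> T"
    and "k \<in> {1..K}"
    and "i \<in> {1..N}"
    and "\<epsilon> > 0"
  shows "(\<lambda>T. measure_pmf.prob (path_pmf K N \<theta> \<sigma> T T)
                {h. \<bar>p_hat K N h k i (j T) - p_star K N \<theta> i\<bar> > \<epsilon>}) \<longlonglongrightarrow> 0"
proof -
  interpret two_phase_rule K N \<theta> \<sigma>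
    using assms by unfold_locales auto
  have nonneg: "\<forall>l\<in>{1..N}. \<theta> l \<ge> 0" and pos: "\<exists>l\<in>{1..N}. \<theta> l > 0"
    using assms(2,3) by (auto simp: less_le)
  obtain \<delta> where d: "\<delta> > 0" and close: "\<And>w. (\<And>l. l \<in> {1..N} \<Longrightarrow> w l > 0 \<and> \<bar>w l - \<theta> l\<bar> < \<delta>) \<Longrightarrow>
       \<bar>normalized_prob K N w i - normalized_prob K N \<theta> i\<bar> \<le> \<epsilon>"
    using normalized_prob_continuous[OF assms(1,7) nonneg pos assms(8)] by blast
  let ?P = "\<lambda>T. path_pmf K N \<theta> \<sigma> T T"
  let ?D = "\<lambda>T l. {h. \<bar>theta_hat N h k l (j T) - \<theta> l\<bar> \<ge> \<delta>}"
  have "(\<lambda>T. \<Sum>l=1..N. measure_pmf.prob (?P T) (?D T l)) \<longlonglongrightarrow> (\<Sum>l=1..N. 0)"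
    using assms(5) by (intro tendsto_sum theta_hat_tendsto_in_prob assms(6) d) auto
  then have lim: "(\<lambda>T. \<Sum>l=1..N. measure_pmf.prob (?P T) (?D T l)) \<longlonglongrightarrow> 0" by simp
  show ?thesis
  proof (rule tendsto_sandwich[OF _ _ tendsto_const lim])
    have "\<forall>\<^sub>F T in sequentially. ln (real T) > real N"
      using filterlim_compose[OF ln_at_top filterlim_real_sequentially] by (auto simp: filterlim_at_top_dense)
    then show "\<forall>\<^sub>F T in sequentially.
        measure_pmf.prob (?P T) {h. \<bar>p_hat K N h k i (j T) - p_star K N \<theta> i\<bar> > \<epsilon>}
        \<le> (\<Sum>l=1..N. measure_pmf.prob (?P T) (?D T l))"
      using eventually_ge_at_top[of 1]
    proof eventually_elim
      case (elim T)
      have jT: "ln (real T) \<le> real (j T)" "j T \<le> T" using assms(5) elim(2) by auto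
      then have j: "N < j T" "N \<le> T" using elim(1) by linarith+
      \<comment> \<open>On a possible path all estimates are positive; if each were within \<delta>
        of its target, continuity would keep \<open>p_hat\<close> within \<epsilon>. So a large
        error forces a deviation in some channel, and a union bound over the channels
        finishes.\<close>
      have "measure_pmf.prob (?P T) {h. \<bar>p_hat K N h k i (j T) - p_star K N \<theta> i\<bar> > \<epsilon>}
          \<le> measure_pmf.prob (?P T) (\<Union>l\<in>{1..N}. ?D T l)"
      proof (intro measure_pmf.finite_measure_mono_AE AE_pmfI impI)
        fix h assume h: "h \<in> set_pmf (?P T)"
          and far: "h \<in> {h. \<bar>p_hat K N h k i (j T) - p_star K N \<theta> i\<bar> > \<epsilon>}"
        have pos_hat: "theta_hat N h k l (j T) > 0" if "l \<in> {1..N}" for l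
          using counts_bounds(1,2)[OF h assms(6) that j(2,1)] by (simp add: theta_hat_def)
        show "h \<in> (\<Union>l\<in>{1..N}. ?D T l)"
        proof (rule ccontr)
          assume "h \<notin> (\<Union>l\<in>{1..N}. ?D T l)"
          then have "\<bar>theta_hat N h k l (j T) - \<theta> l\<bar> < \<delta>" if "l \<in> {1..N}" for l
            using that by (simp add: not_le)
          then have "\<bar>p_hat K N h k i (j T) - p_star K N \<theta> i\<bar> \<le> \<epsilon>"
            unfolding p_hat_def p_star_eq_normalized_prob[OF assms(1,7) pos]
            using pos_hat by (intro close) blast
          then show False using far by simp
        qed
      qed auto
      also have "\<dots> \<le> (\<Sum>l=1..N. measure_pmf.prob (?P T) (?D T l))"
        by (intro measure_pmf.finite_measure_subadditive_finite) auto
      finally show ?case .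
    qed
  qed auto
qed

end
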